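(* Let $\Pi$ be a Gibbs partition with parameters $(\alpha,V)$, let $n\ge1$ and $l\in\{1,\dots,n\}$, and let $C_{l,n}$ be the number of blocks of size $l$ of the restriction of $\Pi$ to $[n]$. Then for $x=0,\dots,\lfloor n/l\rfloor$, $$\mathbb{P}(C_{l,n}=x)=\frac{n!\,[(1-\alpha)_{l-1}]^x}{x!\,(l!)^x}\sum_{r=0}^{\lfloor n/l\rfloor-x}\frac{(-1)^r[(1-\alpha)_{l-1}]^r}{r!\,(l!)^r\,(n-rl-lx)!}\sum_{k-r-x=0}^{n-rl-xl}V_{n,k}\,S^{-1,-\alpha}_{n-rl-xl,\;k-r-x},$$ and $$\mathbb{E}(C_{l,n})=\binom nl(1-\alpha)_{l-1}\sum_{k-1=0}^{n-l}V_{n,k}\,S^{-1,-\alpha}_{n-l,k-1}.$$ In particular, the number of singletons $C_{1,n}$ satisfies, for $x=0,\dots,n$, $$\mathbb{P}(C_{1,n}=x)=\frac{n!}{x!}\sum_{r=0}^{n-x}\frac{(-1)^r}{r!\,(n-r-x)!}\sum_{k-r-x=0}^{n-r-x}V_{n,k}\,S^{-1,-\alpha}_{n-r-x,\,k-r-x},\qquad \mathbb{E}(C_{1,n})=n\sum_{k-1=0}^{n-1}V_{n,k}\,S^{-1,-\alpha}_{n-1,k-1}.$$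
   Context: Notation: $(x)_n=x(x+1)\cdots(x+n-1)$ ($(x)_0=1$); $\sum_{k-a=0}^{M}$ means $k$ ranges over $a,\dots,a+M$. Gibbs partition with parameters $(\alpha,V)$: $\alpha\in(-\infty,1)$ and $V=(V_{n,k})_{1\le k\le n}$ are nonnegative weights with $V_{1,1}=1$ and $V_{n,k}=(n-k\alpha)V_{n+1,k}+V_{n+1,k+1}$; $\Pi$ is the exchangeable random partition of the positive integers such that for every $n$ and every partition $\{A_1,\dots,A_k\}$ of $[n]=\{1,\dots,n\}$, the restriction $\Pi_n$ of $\Pi$ to $[n]$ satisfies $\mathbb{P}(\Pi_n=\{A_1,\dots,A_k\})=V_{n,k}\prod_{i=1}^k(1-\alpha)_{|A_i|-1}$. (Terms multiplied by $S^{-1,-\alpha}_{n,0}=0$ with $V_{n,0}$ are read as $0$.) Generalized central Stirling numbers: $S^{-1,-\alpha}_{n,k}=\frac{n!}{k!}\sum_{(n_1,\dots,n_k)}\prod_{j=1}^k\frac{(1-\alpha)_{n_j-1}}{n_j!}$, the sum being over compositions of $n$ into $k$ positive parts ($S_{0,0}^{-1,-\alpha}=1$, $S_{n,0}^{-1,-\alpha}=0$ for $n\ge1$, $S_{n,k}^{-1,-\alpha}=0$ for $k>n$). *)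

theory Defs
  imports "HOL-Probability.Probability"
begin

definition restrict_partition :: "nat \<Rightarrow> nat set set \<Rightarrow> nat set set" where
  "restrict_partition n A = (\<lambda>B. B \<inter> {1..n}) ` A - {{}}"

(* The sigma-algebra on partitions of the positive integers is the one generated by all
   restrictions to {1..n}; hence measurability is required of each restriction. A restriction
   has finite range, so the discrete target sigma-algebra imposes nothing extra. *)
definition random_partition :: "'w measure \<Rightarrow> ('w \<Rightarrow> nat set set) \<Rightarrow> bool" where
  "random_partition M P \<longleftrightarrow>
     (\<forall>\<omega>\<in>space M. partition_on {1..} (P \<omega>)) \<and>
     (\<forall>n. (\<lambda>\<omega>. restrict_partition n (P \<omega>)) \<in> M \<rightarrow>\<^sub>M count_space UNIV)"

definition exchangeable_partition :: "'w measure \<Rightarrow> ('w \<Rightarrow> nat set set) \<Rightarrow> bool" where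
  "exchangeable_partition M P \<longleftrightarrow>
     (\<forall>n \<sigma>. \<sigma> permutes {1..n} \<longrightarrow>
        distr M (count_space UNIV) (\<lambda>\<omega>. (\<lambda>B. \<sigma> ` B) ` restrict_partition n (P \<omega>)) =
        distr M (count_space UNIV) (\<lambda>\<omega>. restrict_partition n (P \<omega>)))"

definition gibbs_weights :: "real \<Rightarrow> (nat \<Rightarrow> nat \<Rightarrow> real) \<Rightarrow> bool" where
  "gibbs_weights \<alpha> V \<longleftrightarrow>
     (\<forall>n k. 1 \<le> k \<and> k \<le> n \<longrightarrow> V n k \<ge> 0) \<and>
     V 1 1 = 1 \<and>
     (\<forall>n k. 1 \<le> k \<and> k \<le> n \<longrightarrow>
        V n k = (real n - real k * \<alpha>) * V (n + 1) k + V (n + 1) (k + 1))"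

(* Exchangeability already follows from gibbs_law, whose right-hand side depends on the
   partition only through its block sizes. *)
locale gibbs_partition = prob_space M
  for M :: "'w measure" +
  fixes \<alpha> :: real and V :: "nat \<Rightarrow> nat \<Rightarrow> real" and P :: "'w \<Rightarrow> nat set set"
  assumes alpha_less_1: "\<alpha> < 1"
    and weights: "gibbs_weights \<alpha> V"
    and random: "random_partition M P"
    and exchangeable: "exchangeable_partition M P"
    and gibbs_law: "\<And>n A. n \<ge> 1 \<Longrightarrow> partition_on {1..n} A \<Longrightarrow>
          prob {\<omega> \<in> space M. restrict_partition n (P \<omega>) = A} =
            V n (card A) * (\<Prod>B\<in>A. pochhammer (1 - \<alpha>) (card B - 1))"

definition block_count :: "('w \<Rightarrow> nat set set) \<Rightarrow> nat \<Rightarrow> nat \<Rightarrow> 'w \<Rightarrow> nat" where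
  "block_count P l n \<omega> = card {B \<in> restrict_partition n (P \<omega>). card B = l}"

definition compositions :: "nat \<Rightarrow> nat \<Rightarrow> nat list set" where
  "compositions n k = {ns. length ns = k \<and> sum_list ns = n \<and> (\<forall>m\<in>set ns. m \<ge> 1)}"

(* gen_stirling \<alpha> n k is the generalized central Stirling number with superscript
   (-1, -\<alpha>) and subscript (n, k). *)
definition gen_stirling :: "real \<Rightarrow> nat \<Rightarrow> nat \<Rightarrow> real" where
  "gen_stirling \<alpha> n k = fact n / fact k *
     (\<Sum>ns\<in>compositions n k. \<Prod>m\<leftarrow>ns. pochhammer (1 - \<alpha>) (m - 1) / fact m)"

lemma finite_compositions: "finite (compositions n k)"
proof (rule finite_subset)
  show "compositions n k \<subseteq> {ns. set ns \<subseteq> {..n} \<and> length ns = k}"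
    by (auto simp: compositions_def dest: member_le_sum_list)
qed (simp add: finite_lists_length_eq)

lemma gen_stirling_0_0: "gen_stirling \<alpha> 0 0 = 1"
proof -
  have "compositions 0 0 = {[]}"
    by (auto simp: compositions_def)
  then show ?thesis
    by (simp add: gen_stirling_def)
qed

lemma gen_stirling_n_0: "n \<ge> 1 \<Longrightarrow> gen_stirling \<alpha> n 0 = 0"
  by (auto simp: gen_stirling_def compositions_def intro!: sum.neutral)

lemma gen_stirling_less:
  assumes "n < k"
  shows "gen_stirling \<alpha> n k = 0"
proof -
  have "length ns \<le> sum_list ns" if "\<forall>m\<in>set ns. m \<ge> 1" for ns :: "nat list"
    using that by (induction ns) auto
  then have "compositions n k = {}"
    using assms by (fastforce simp: compositions_def simp flip: not_le)
  then show ?thesis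
    by (simp add: gen_stirling_def)
qed

end

theory Submission imports Defs begin

text \<open>
  By the exponential formula, summing \<open>\<Prod>B\<in>A. w (card B)\<close> over the partitions \<open>A\<close> of an \<open>n\<close>-set into
  \<open>k\<close> blocks gives \<open>n! / k!\<close> times the coefficient of \<open>z\<^sup>n\<close> in \<open>F\<^sup>k\<close>, where
  \<open>F\<close> is the exponential generating function of \<open>w\<close> without constant term. Multiplying the weight
  of size \<open>l\<close> by \<open>t\<close> replaces \<open>F\<close> by \<open>F + (t - 1) w(l) z\<^sup>l / l!\<close>, so the binomial theorem expands
  the probability generating function \<open>E(t\<^sup>C)\<close> of the number \<open>C\<close> of blocks of size \<open>l\<close> in powers
  of \<open>t - 1\<close>. The law of \<open>C\<close> is read off from the coefficients in powers of \<open>t\<close>, and the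
  expectation is the derivative at \<open>t = 1\<close>.
\<close>

section \<open>Exponential formula for partitions into a given number of blocks\<close>

definition block_fps :: "(nat \<Rightarrow> real) \<Rightarrow> real fps" where
  "block_fps w = Abs_fps (\<lambda>b. if b = 0 then 0 else w b / fact b)"

definition partitions_into :: "'a set \<Rightarrow> nat \<Rightarrow> 'a set set set" where
  "partitions_into U k = {A. partition_on U A \<and> card A = k}"

lemma finite_partitions_into: "finite U \<Longrightarrow> finite (partitions_into U k)"
  by (rule finite_subset[OF _ finitely_many_partition_on]) (auto simp: partitions_into_def)

text \<open>Double counting of partitions with a marked block: each partition on the left offers
  \<open>Suc k\<close> choices of mark, and removing the marked block \<open>B\<close> leaves an
  arbitrary partition of \<open>U - B\<close> into \<open>k\<close> blocks.\<close>

lemma sum_marked_block: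
  fixes w :: "nat \<Rightarrow> real"
  assumes "finite U"
  shows "real (Suc k) * (\<Sum>A\<in>partitions_into U (Suc k). \<Prod>B\<in>A. w (card B)) =
         (\<Sum>B\<in>Pow U - {{}}. w (card B) * (\<Sum>A\<in>partitions_into (U - B) k. \<Prod>C\<in>A. w (card C)))"
proof -
  let ?p = "\<lambda>A. \<Prod>B\<in>A. w (card B)"
  have fin: "finite A" if "A \<in> partitions_into U' k'" "U' \<subseteq> U" for A U' k'
    using that finite_elements finite_subset[OF _ assms] unfolding partitions_into_def by blast
  have "real (Suc k) * (\<Sum>A\<in>partitions_into U (Suc k). ?p A) =
        (\<Sum>A\<in>partitions_into U (Suc k). \<Sum>B\<in>A. ?p A)"
    by (simp add: partitions_into_def sum_distrib_left)
  also have "\<dots> = (\<Sum>(A, B)\<in>Sigma (partitions_into U (Suc k)) (\<lambda>A. A). ?p A)"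
    by (rule sum.Sigma) (use assms fin finite_partitions_into in auto)
  also have "\<dots> = (\<Sum>(B, A)\<in>Sigma (Pow U - {{}}) (\<lambda>B. partitions_into (U - B) k). w (card B) * ?p A)"
  proof (rule sum.reindex_bij_witness[where j = "\<lambda>(A, B). (B, A - {B})" and i = "\<lambda>(B, A). (insert B A, B)"])
    fix x assume "x \<in> Sigma (partitions_into U (Suc k)) (\<lambda>A. A)"
    then obtain A B where x: "x = (A, B)" "A \<in> partitions_into U (Suc k)" "B \<in> A"
      by auto
    have A: "partition_on U A" "card A = Suc k" "finite A"
      using x fin[OF x(2)] by (auto simp: partitions_into_def)
    have disj: "disjnt B (\<Union>(A - {B}))"
      using partition_onD2[OF A(1)] x(3) by (auto simp: disjnt_def disjoint_def)
    have ins: "insert B (A - {B}) = A"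
      using x(3) by auto
    show "(case (case x of (A, B) \<Rightarrow> (B, A - {B})) of (B, A) \<Rightarrow> (insert B A, B)) = x"
      using x ins by simp
    show "(case x of (A, B) \<Rightarrow> (B, A - {B})) \<in> Sigma (Pow U - {{}}) (\<lambda>B. partitions_into (U - B) k)"
      using partition_on_insert[OF disj, of U] A x unfolding ins by (auto simp: partitions_into_def)
    show "(case (case x of (A, B) \<Rightarrow> (B, A - {B})) of (B, A) \<Rightarrow> w (card B) * ?p A) =
          (case x of (A, B) \<Rightarrow> ?p A)"
      using x A by (simp add: prod.remove[of A B])
  next
    fix x assume "x \<in> Sigma (Pow U - {{}}) (\<lambda>B. partitions_into (U - B) k)"
    then obtain A B where x: "x = (B, A)" "B \<subseteq> U" "B \<noteq> {}" "A \<in> partitions_into (U - B) k"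
      by auto
    have A: "partition_on (U - B) A" "card A = k" "finite A"
      using x fin[OF x(4)] by (auto simp: partitions_into_def)
    have disj: "disjnt B (\<Union>A)"
      using partition_onD1[OF A(1)] by (auto simp: disjnt_def)
    \<comment> \<open>A nonempty set disjoint from all blocks of \<open>A\<close> is not one of
      them, so inserting \<open>B\<close> raises the cardinality and deleting it again recovers
      \<open>A\<close>.\<close>
    have "B \<notin> A"
      using disj x(3) by (auto simp: disjnt_def)
    then show "(case (case x of (B, A) \<Rightarrow> (insert B A, B)) of (A, B) \<Rightarrow> (B, A - {B})) = x"
      using x by simp
    show "(case x of (B, A) \<Rightarrow> (insert B A, B)) \<in> Sigma (partitions_into U (Suc k)) (\<lambda>A. A)"
      using partition_on_insert[OF disj, of U] A x \<open>B \<notin> A\<close> by (auto simp: partitions_into_def)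
  qed
  also have "\<dots> = (\<Sum>B\<in>Pow U - {{}}. \<Sum>A\<in>partitions_into (U - B) k. w (card B) * ?p A)"
    by (rule sum.Sigma[symmetric]) (use assms in \<open>simp_all add: finite_partitions_into\<close>)
  finally show ?thesis
    by (simp add: sum_distrib_left)
qed

lemma sum_Pow_card:
  fixes f :: "nat \<Rightarrow> real"
  assumes "finite U"
  shows "(\<Sum>B\<in>Pow U. f (card B)) = (\<Sum>b\<le>card U. real (card U choose b) * f b)"
proof -
  have "(\<Sum>B\<in>Pow U. f (card B)) = (\<Sum>b\<le>card U. \<Sum>B\<in>{B \<in> Pow U. card B = b}. f (card B))"
    by (rule sum.group[symmetric]) (use assms card_mono in auto)
  then show ?thesis
    using n_subsets[OF assms] by simp
qed

text \<open>Induction on the number of blocks: splitting off a marked block of size \<open>b\<close>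
  brings in a binomial coefficient, whose factorials turn the recursion into the Cauchy product of
  \<open>block_fps w\<close> and its \<open>k\<close>-th power.\<close>

lemma sum_partitions_into:
  fixes w :: "nat \<Rightarrow> real"
  assumes "finite U"
  shows "(\<Sum>A\<in>partitions_into U k. \<Prod>B\<in>A. w (card B)) =
         fact (card U) / fact k * fps_nth (block_fps w ^ k) (card U)"
  using assms
proof (induction k arbitrary: U)
  case 0
  have "partitions_into U 0 = (if U = {} then {{}} else {})"
    using finite_elements[OF 0] by (auto simp: partitions_into_def partition_on_empty partition_on_def)
  then show ?case
    using 0 by auto
next
  case (Suc k)
  let ?F = "block_fps w" and ?m = "card U"
  let ?g = "\<lambda>b. if b = 0 then 0 else w b * (fact (?m - b) / fact k * fps_nth (?F ^ k) (?m - b))"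
  have "real (Suc k) * (\<Sum>A\<in>partitions_into U (Suc k). \<Prod>B\<in>A. w (card B)) =
        (\<Sum>B\<in>Pow U - {{}}. w (card B) * (\<Sum>A\<in>partitions_into (U - B) k. \<Prod>C\<in>A. w (card C)))"
    by (rule sum_marked_block) fact
  also have "\<dots> = (\<Sum>B\<in>Pow U - {{}}. ?g (card B))"
  proof (rule sum.cong[OF refl])
    fix B assume B: "B \<in> Pow U - {{}}"
    then have "finite B" "card (U - B) = ?m - card B" "card B \<noteq> 0"
      using Suc.prems by (auto simp: card_Diff_subset finite_subset)
    then show "w (card B) * (\<Sum>A\<in>partitions_into (U - B) k. \<Prod>C\<in>A. w (card C)) = ?g (card B)"
      using Suc.IH[of "U - B"] Suc.prems by simp
  qed
  also have "\<dots> = (\<Sum>B\<in>Pow U. ?g (card B))"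
    by (rule sum.mono_neutral_left) (use Suc.prems in auto)
  also have "\<dots> = (\<Sum>b\<le>?m. real (?m choose b) * ?g b)"
    by (rule sum_Pow_card) fact
  also have "\<dots> = (\<Sum>b\<le>?m. fact ?m / fact k * (fps_nth ?F b * fps_nth (?F ^ k) (?m - b)))"
    by (rule sum.cong) (auto simp: block_fps_def binomial_fact field_simps)
  also have "\<dots> = fact ?m / fact k * fps_nth (?F ^ Suc k) ?m"
    by (simp add: fps_mult_nth sum_distrib_left atLeast0AtMost)
  finally have "(\<Sum>A\<in>partitions_into U (Suc k). \<Prod>B\<in>A. w (card B)) =
      fact ?m / fact k * fps_nth (?F ^ Suc k) ?m / real (Suc k)"
    by (subst nonzero_eq_divide_eq)
       (simp_all only: mult.commute of_nat_eq_0_iff nat.distinct not_False_eq_True)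
  then show ?case
    by (simp add: mult.commute)
qed

section \<open>Generalized Stirling numbers as power series coefficients\<close>

lemma sum_compositions:
  "(\<Sum>ns\<in>compositions n k. \<Prod>m\<leftarrow>ns. w m / fact m) = fps_nth (block_fps w ^ k) n"
proof (induction k arbitrary: n)
  case 0
  have "compositions n 0 = (if n = 0 then {[]} else {})"
    by (auto simp: compositions_def)
  then show ?case
    by auto
next
  case (Suc k)
  let ?p = "\<lambda>ns. \<Prod>m\<leftarrow>ns. w m / fact m"
  \<comment> \<open>Splitting off the first part gives the same Cauchy product; the missing constant
    term of \<open>block_fps\<close> matches the exclusion of zero parts.\<close>
  have eq: "compositions n (Suc k) = (\<lambda>(b, ns). b # ns) ` Sigma {1..n} (\<lambda>b. compositions (n - b) k)"
  proof (intro equalityI subsetI)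
    fix ns assume "ns \<in> compositions n (Suc k)"
    then show "ns \<in> (\<lambda>(b, ns). b # ns) ` Sigma {1..n} (\<lambda>b. compositions (n - b) k)"
      by (cases ns) (auto simp: compositions_def image_def)
  qed (auto simp: compositions_def)
  have "(\<Sum>ns\<in>compositions n (Suc k). ?p ns) =
        (\<Sum>(b, ns)\<in>Sigma {1..n} (\<lambda>b. compositions (n - b) k). w b / fact b * ?p ns)"
    unfolding eq by (subst sum.reindex) (auto simp: inj_on_def intro!: sum.cong)
  also have "\<dots> = (\<Sum>b=1..n. w b / fact b * fps_nth (block_fps w ^ k) (n - b))"
    by (subst sum.Sigma[symmetric]) 
       (simp_all only: finite_compositions Suc.IH finite_atLeastAtMost ball_triv simp_thms
         flip: sum_distrib_left)
  also have "\<dots> = (\<Sum>b=0..n. fps_nth (block_fps w) b * fps_nth (block_fps w ^ k) (n - b))"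
    by (rule sum.mono_neutral_cong_left) (auto simp: block_fps_def)
  finally show ?case
    by (simp add: fps_mult_nth)
qed

lemma gen_stirling_fps:
  "gen_stirling \<alpha> n k =
     fact n / fact k * fps_nth (block_fps (\<lambda>b. pochhammer (1 - \<alpha>) (b - 1)) ^ k) n"
  unfolding gen_stirling_def sum_compositions[symmetric] by simp

section \<open>Marking the blocks of size l\<close>

lemma block_fps_tilt:
  assumes "l \<ge> 1"
  shows "block_fps (\<lambda>b. if b = l then t * w b else w b) =
         block_fps w + fps_const ((t - 1) * w l / fact l) * fps_X ^ l"
  using assms by (auto simp: block_fps_def fps_eq_iff field_simps)

text \<open>Binomial theorem for power series. The guard is essential: for \<open>j * l > m\<close>
  the coefficient vanishes, while truncated subtraction would read off the constant term of
  \<open>F ^ (k - j)\<close>.\<close>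

lemma fps_nth_tilt_power:
  fixes F :: "real fps"
  shows "fps_nth ((F + fps_const u * fps_X ^ l) ^ k) m =
         (\<Sum>j\<le>k. if j * l \<le> m then real (k choose j) * u ^ j * fps_nth (F ^ (k - j)) (m - j * l) else 0)"
proof -
  have "(F + fps_const u * fps_X ^ l) ^ k =
        (\<Sum>j\<le>k. fps_const (real (k choose j) * u ^ j) * (fps_X ^ (j * l) * F ^ (k - j)))"
    unfolding add.commute[of F] binomial_ring
  proof (rule sum.cong[OF refl])
    fix j
    have "(fps_const u * fps_X ^ l) ^ j = fps_const (u ^ j) * fps_X ^ (j * l)"
      by (simp only: power_mult_distrib fps_const_power power_mult[symmetric] mult.commute)
    then show "of_nat (k choose j) * (fps_const u * fps_X ^ l) ^ j * F ^ (k - j) =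
        fps_const (real (k choose j) * u ^ j) * (fps_X ^ (j * l) * F ^ (k - j))"
      by (simp only: fps_of_nat[symmetric] fps_const_mult[symmetric] mult.assoc)
  qed
  then show ?thesis
    by (simp add: fps_sum_nth fps_X_power_mult_nth if_distrib cong: if_cong) (auto intro!: sum.cong)
qed


lemma partition_on_card_le:
  assumes "finite U" "partition_on U A"
  shows "card A \<le> card U"
proof -
  have "card U = (\<Sum>B\<in>A. card B)"
    using assms by (intro product_partition)
       (auto simp: partition_on_def intro: finite_subset)
  moreover have "(\<Sum>B\<in>A. 1) \<le> (\<Sum>B\<in>A. card B)"
  proof (rule sum_mono)
    fix B assume "B \<in> A"
    then have "finite B" "B \<noteq> {}"
      using assms by (auto simp: partition_on_def intro: finite_subset)
    then show "1 \<le> card B"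
      by (simp add: Suc_le_eq card_gt_0_iff)
  qed
  ultimately show ?thesis
    by simp
qed

text \<open>The binomial moment \<open>E(C choose j)\<close> of the number \<open>C\<close> of blocks of size \<open>l\<close>, when \<open>f = V n\<close>.\<close>

definition block_moment :: "real \<Rightarrow> (nat \<Rightarrow> real) \<Rightarrow> nat \<Rightarrow> nat \<Rightarrow> nat \<Rightarrow> real" where
  "block_moment \<alpha> f l n j =
     fact n * pochhammer (1 - \<alpha>) (l - 1) ^ j / (fact j * fact l ^ j * fact (n - j * l)) *
     (\<Sum>k=j..j + (n - j * l). f k * gen_stirling \<alpha> (n - j * l) (k - j))"

text \<open>The factor \<open>t\<close> per block of size \<open>l\<close> is absorbed into the
  weight \<open>w'\<close>. The sum is then split by the number \<open>k\<close> of blocks, each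
  level is expanded in powers of \<open>t - 1\<close>, and the sums over \<open>k\<close> and
  \<open>j\<close> are exchanged.\<close>

lemma pgf_block_count:
  fixes f :: "nat \<Rightarrow> real"
  assumes U: "finite U" "card U = n" and l: "l \<ge> 1"
  shows "(\<Sum>A | partition_on U A. f (card A) * (\<Prod>B\<in>A. pochhammer (1 - \<alpha>) (card B - 1)) *
            t ^ card {B \<in> A. card B = l}) =
         (\<Sum>j\<le>n div l. block_moment \<alpha> f l n j * (t - 1) ^ j)"
proof -
  define w where "w b = pochhammer (1 - \<alpha>) (b - 1)" for b
  define w' where "w' b = (if b = l then t * w b else w b)" for b
  define u where "u = (t - 1) * w l / fact l"
  \<comment> \<open>The term of the expansion in which \<open>j\<close> of the \<open>k\<close>
    factors contribute the correction; \<open>k!\<close> and \<open>(k - j)!\<close> have cancelled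
    against the binomial coefficient and the Stirling normalization.\<close>
  define T where "T j k = fact n / (fact j * fact (n - j * l)) * u ^ j * gen_stirling \<alpha> (n - j * l) (k - j)" for j k
  have le: "j * l \<le> n \<longleftrightarrow> j \<le> n div l" for j
    using l by (simp add: less_eq_div_iff_mult_less_eq)
  have G: "fps_nth (block_fps w ^ i) m = fact i / fact m * gen_stirling \<alpha> m i" for i m
    by (simp add: gen_stirling_fps w_def[abs_def])
  have weight: "(\<Prod>B\<in>A. w (card B)) * t ^ card {B \<in> A. card B = l} = (\<Prod>B\<in>A. w' (card B))"
    if "partition_on U A" for A
  proof -
    have "finite A"
      using that U finite_elements by blast
    then have "t ^ card {B \<in> A. card B = l} = (\<Prod>B\<in>A. if card B = l then t else 1)"
      by (simp add: prod.inter_filter[symmetric])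
    then show ?thesis
      by (auto simp: prod.distrib[symmetric] w'_def intro!: prod.cong)
  qed
  have level: "(\<Sum>A\<in>partitions_into U k. \<Prod>B\<in>A. w' (card B)) =
      (\<Sum>j\<le>n div l. if j \<le> k then T j k else 0)" for k
  proof -
    have "(\<Sum>A\<in>partitions_into U k. \<Prod>B\<in>A. w' (card B)) =
          fact n / fact k * (\<Sum>j\<le>k. if j * l \<le> n then
             real (k choose j) * u ^ j * fps_nth (block_fps w ^ (k - j)) (n - j * l) else 0)"
      unfolding sum_partitions_into[OF U(1)] U(2)
      unfolding w'_def block_fps_tilt[OF l] fps_nth_tilt_power u_def ..
    also have "\<dots> = (\<Sum>j\<le>k. if j \<le> n div l then T j k else 0)"
      unfolding sum_distrib_left
      by (rule sum.cong) (auto simp: le G T_def binomial_fact field_simps)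
    \<comment> \<open>The roles of the two bounds on \<open>j\<close> are swapped, making the index
      range independent of \<open>k\<close> for the later exchange of sums.\<close>
    also have "\<dots> = (\<Sum>j\<in>{..k} \<inter> {..n div l}. T j k)"
      by (subst sum.inter_restrict) simp_all
    also have "\<dots> = (\<Sum>j\<in>{..n div l} \<inter> {..k}. T j k)"
      by (simp add: Int_commute)
    also have "\<dots> = (\<Sum>j\<le>n div l. if j \<le> k then T j k else 0)"
      by (subst sum.inter_restrict) simp_all
    finally show ?thesis .
  qed
  have T_sum: "(\<Sum>k\<le>n. f k * (if j \<le> k then T j k else 0)) = block_moment \<alpha> f l n j * (t - 1) ^ j"
    if "j \<le> n div l" for j
  proof -
    \<comment> \<open>Since l \<ge> 1, the range of \<open>k\<close> in \<open>block_moment\<close>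
      stays within \<open>{..n}\<close>; any larger \<open>k\<close> contributes a Stirling number
      whose lower index exceeds its upper one.\<close>
    have "j * l \<le> n" "j \<le> j * l"
      using that l by (auto simp: le)
    then have "j + (n - j * l) \<le> n"
      by linarith
    then have "(\<Sum>k\<le>n. f k * (if j \<le> k then T j k else 0)) = (\<Sum>k=j..j + (n - j * l). f k * T j k)"
      by (intro sum.mono_neutral_cong_right) (auto simp: T_def gen_stirling_less)
    also have "\<dots> = block_moment \<alpha> f l n j * (t - 1) ^ j"
      unfolding block_moment_def T_def u_def sum_distrib_left sum_distrib_right w_def
      by (rule sum.cong) (simp_all add: power_mult_distrib power_divide mult_ac)
    finally show ?thesis .
  qed
  have "(\<Sum>A | partition_on U A. f (card A) * (\<Prod>B\<in>A. w (card B)) * t ^ card {B \<in> A. card B = l}) =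
        (\<Sum>A | partition_on U A. f (card A) * (\<Prod>B\<in>A. w' (card B)))"
    by (rule sum.cong) (auto simp: weight mult.assoc)
  also have "\<dots> = (\<Sum>k\<le>n. \<Sum>A | A \<in> {A. partition_on U A} \<and> card A = k. f (card A) * (\<Prod>B\<in>A. w' (card B)))"
    by (rule sum.group[symmetric]) (use U partition_on_card_le finitely_many_partition_on in auto)
  also have "\<dots> = (\<Sum>k\<le>n. f k * (\<Sum>A\<in>partitions_into U k. \<Prod>B\<in>A. w' (card B)))"
    by (auto simp: partitions_into_def sum_distrib_left intro!: sum.cong)
  also have "\<dots> = (\<Sum>j\<le>n div l. \<Sum>k\<le>n. f k * (if j \<le> k then T j k else 0))"
    unfolding level sum_distrib_left by (rule sum.swap)
  also have "\<dots> = (\<Sum>j\<le>n div l. block_moment \<alpha> f l n j * (t - 1) ^ j)"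
    by (rule sum.cong) (simp_all add: T_sum)
  finally show ?thesis
    by (simp add: w_def)
qed

section \<open>Polynomials expanded around 0 and around 1\<close>

lemma poly_recentred_eq:
  fixes p a :: "_ \<Rightarrow> real"
  assumes "\<And>t. (\<Sum>i\<in>I. p i * t ^ c i) = (\<Sum>j\<le>N. a j * (t - 1) ^ j)"
  shows "(\<Sum>i\<in>I. monom (p i) (c i)) = (\<Sum>j\<le>N. smult (a j) ([:-1, 1:] ^ j))"
  by (rule poly_ext) (simp add: poly_sum poly_monom poly_power assms)

text \<open>Comparison of the coefficients of \<open>t ^ x\<close>, where \<open>(t - 1) ^ j\<close>
  contributes only for j \<ge> x; the shift \<open>j = r + x\<close> gives the alternating
  sum.\<close>

lemma coeff_recentred:
  fixes p a :: "_ \<Rightarrow> real"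
  assumes "finite I" and "\<And>t. (\<Sum>i\<in>I. p i * t ^ c i) = (\<Sum>j\<le>N. a j * (t - 1) ^ j)" and "x \<le> N"
  shows "(\<Sum>i | i \<in> I \<and> c i = x. p i) = (\<Sum>r=0..N - x. (-1) ^ r * real (r + x choose x) * a (r + x))"
proof -
  have "(\<Sum>i | i \<in> I \<and> c i = x. p i) = coeff (\<Sum>i\<in>I. monom (p i) (c i)) x"
    using assms(1) by (simp add: coeff_sum sum.inter_filter)
  also have "\<dots> = (\<Sum>j\<le>N. a j * coeff ([:-1, 1:] ^ j) x)"
    unfolding poly_recentred_eq[OF assms(2)] by (simp add: coeff_sum)
  also have "\<dots> = (\<Sum>j=x..N. a j * (real (j choose x) * (-1) ^ (j - x)))"
    by (rule sum.mono_neutral_cong_right)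
       (auto simp: coeff_linear_poly_power coeff_eq_0 degree_linear_power)
  also have "\<dots> = (\<Sum>r=0..N - x. (-1) ^ r * real (r + x choose x) * a (r + x))"
    by (rule sum.reindex_bij_witness[where i = "\<lambda>r. r + x" and j = "\<lambda>j. j - x"])
       (use assms(3) in auto)
  finally show ?thesis .
qed

lemma derivative_recentred:
  fixes p a :: "_ \<Rightarrow> real"
  assumes "\<And>t. (\<Sum>i\<in>I. p i * t ^ c i) = (\<Sum>j\<le>N. a j * (t - 1) ^ j)" and "1 \<le> N"
  shows "(\<Sum>i\<in>I. real (c i) * p i) = a 1"
proof -
  have "((\<lambda>t. \<Sum>i\<in>I. p i * t ^ c i) has_field_derivative (\<Sum>i\<in>I. real (c i) * p i)) (at 1)"
    by (auto intro!: derivative_eq_intros sum.cong)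
  moreover have "((\<lambda>t. \<Sum>j\<le>N. a j * (t - 1) ^ j) has_field_derivative
      (\<Sum>j\<le>N. a j * (real j * 0 ^ (j - 1)))) (at 1)"
    by (auto intro!: derivative_eq_intros sum.cong)
  ultimately have "(\<Sum>i\<in>I. real (c i) * p i) = (\<Sum>j\<le>N. a j * (real j * 0 ^ (j - 1)))"
    unfolding assms(1) by (rule DERIV_unique)
  \<comment> \<open>Truncated subtraction makes \<open>0 ^ (j - 1)\<close> equal to 1 at
    \<open>j = 0\<close> as well; there the factor \<open>real j\<close> removes the term.\<close>
  also have "\<dots> = (\<Sum>j\<in>{1}. a j * (real j * 0 ^ (j - 1)))"
    by (rule sum.mono_neutral_right) (use assms(2) in \<open>auto simp: power_0_left\<close>)
  finally show ?thesis
    by simp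
qed

section \<open>Law and mean of the block count\<close>

context gibbs_partition
begin

lemma partition_on_restrict_partition:
  assumes "\<omega> \<in> space M"
  shows "partition_on {1..n} (restrict_partition n (P \<omega>))"
proof -
  have "partition_on {1..} (P \<omega>)"
    using random assms by (simp add: random_partition_def)
  from partition_on_restrict[OF this, of "{1..n}"] show ?thesis
    by (simp add: restrict_partition_def Int_commute Int_absorb2 Icc_subset_Ici_iff)
qed

lemma measurable_restrict_partition [measurable]:
  "(\<lambda>\<omega>. restrict_partition n (P \<omega>)) \<in> M \<rightarrow>\<^sub>M count_space UNIV"
  using random by (simp add: random_partition_def)

text \<open>The restriction takes finitely many values, so \<open>g\<close> of it is a finite
  combination of indicators of events whose probabilities are given by
  \<open>gibbs_law\<close>.\<close>

lemma expectation_restrict_partition: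
  fixes g :: "nat set set \<Rightarrow> real"
  assumes "n \<ge> 1"
  shows "expectation (\<lambda>\<omega>. g (restrict_partition n (P \<omega>))) =
    (\<Sum>A | partition_on {1..n} A. V n (card A) * (\<Prod>B\<in>A. pochhammer (1 - \<alpha>) (card B - 1)) * g A)"
proof -
  let ?R = "\<lambda>\<omega>. restrict_partition n (P \<omega>)" and ?\<P> = "{A. partition_on {1..n} A}"
  have fin: "finite ?\<P>"
    by (rule finitely_many_partition_on) simp
  have [measurable]: "{\<omega> \<in> space M. ?R \<omega> = A} \<in> events" for A
    by measurable
  have "expectation (\<lambda>\<omega>. g (?R \<omega>)) =
        expectation (\<lambda>\<omega>. \<Sum>A\<in>?\<P>. g A * indicator {\<omega> \<in> space M. ?R \<omega> = A} \<omega>)"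
  proof (rule Bochner_Integration.integral_cong[OF refl])
    fix \<omega> assume \<omega>: "\<omega> \<in> space M"
    have "(\<Sum>A\<in>?\<P>. g A * indicator {\<omega> \<in> space M. ?R \<omega> = A} \<omega>) = (\<Sum>A\<in>?\<P>. if A = ?R \<omega> then g A else 0)"
      using \<omega> by (intro sum.cong) (auto simp: indicator_def)
    also have "\<dots> = g (?R \<omega>)"
      using fin partition_on_restrict_partition[OF \<omega>, of n] by simp
    finally show "g (?R \<omega>) = (\<Sum>A\<in>?\<P>. g A * indicator {\<omega> \<in> space M. ?R \<omega> = A} \<omega>)" ..
  qed
  also have "\<dots> = (\<Sum>A\<in>?\<P>. g A * prob {\<omega> \<in> space M. ?R \<omega> = A})"
    by (subst Bochner_Integration.integral_sum) (simp_all add: emeasure_eq_measure)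
  also have "\<dots> = (\<Sum>A\<in>?\<P>. V n (card A) * (\<Prod>B\<in>A. pochhammer (1 - \<alpha>) (card B - 1)) * g A)"
    by (rule sum.cong) (simp_all add: gibbs_law[OF assms])
  finally show ?thesis .
qed

lemma pgf:
  assumes "l \<ge> 1"
  shows "(\<Sum>A | partition_on {1..n} A. V n (card A) * (\<Prod>B\<in>A. pochhammer (1 - \<alpha>) (card B - 1)) *
            t ^ card {B \<in> A. card B = l}) =
         (\<Sum>j\<le>n div l. block_moment \<alpha> (V n) l n j * (t - 1) ^ j)"
  using assms by (intro pgf_block_count) simp_all

lemma prob_block_count:
  assumes "n \<ge> 1" "l \<ge> 1" "x \<le> n div l"
  shows "prob {\<omega> \<in> space M. block_count P l n \<omega> = x} =
          fact n * pochhammer (1 - \<alpha>) (l - 1) ^ x / (fact x * fact l ^ x) *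
          (\<Sum>r = 0..n div l - x.
             (-1) ^ r * pochhammer (1 - \<alpha>) (l - 1) ^ r /
               (fact r * fact l ^ r * fact (n - r * l - l * x)) *
             (\<Sum>k = r + x..r + x + (n - r * l - x * l).
                V n k * gen_stirling \<alpha> (n - r * l - x * l) (k - r - x)))"
proof -
  let ?c = "\<lambda>A :: nat set set. card {B \<in> A. card B = l}"
  let ?p = "\<lambda>A. V n (card A) * (\<Prod>B\<in>A. pochhammer (1 - \<alpha>) (card B - 1))"
  let ?\<P> = "{A. partition_on {1..n} A}"
  have fin: "finite ?\<P>"
    by (rule finitely_many_partition_on) simp
  have "prob {\<omega> \<in> space M. block_count P l n \<omega> = x} =
        expectation (indicator {\<omega> \<in> space M. block_count P l n \<omega> = x})"
    by (simp add: Int_absorb2)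
  also have "\<dots> = expectation (\<lambda>\<omega>. of_bool (?c (restrict_partition n (P \<omega>)) = x))"
    by (rule Bochner_Integration.integral_cong) (auto simp: block_count_def indicator_def)
  also have "\<dots> = (\<Sum>A\<in>?\<P>. ?p A * of_bool (?c A = x))"
    by (rule expectation_restrict_partition) fact
  also have "\<dots> = (\<Sum>A | A \<in> ?\<P> \<and> ?c A = x. ?p A)"
    by (subst sum.inter_filter[OF fin]) (simp add: of_bool_def if_distrib cong: if_cong)
  \<comment> \<open>The probability has become the coefficient of \<open>t ^ x\<close> in the
    generating function \<open>pgf\<close>.\<close>
  also have "\<dots> = (\<Sum>r=0..n div l - x. (-1) ^ r * real (r + x choose x) * block_moment \<alpha> (V n) l n (r + x))"
    by (rule coeff_recentred[OF fin pgf]) fact+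
  also have "\<dots> = fact n * pochhammer (1 - \<alpha>) (l - 1) ^ x / (fact x * fact l ^ x) *
          (\<Sum>r = 0..n div l - x.
             (-1) ^ r * pochhammer (1 - \<alpha>) (l - 1) ^ r /
               (fact r * fact l ^ r * fact (n - r * l - l * x)) *
             (\<Sum>k = r + x..r + x + (n - r * l - x * l).
                V n k * gen_stirling \<alpha> (n - r * l - x * l) (k - r - x)))"
    unfolding sum_distrib_left[of _ _ "{0..n div l - x}"]
  proof (rule sum.cong[OF refl])
    fix r assume "r \<in> {0..n div l - x}"
    have eqs: "n - (r + x) * l = n - r * l - x * l" "k - (r + x) = k - r - x" "l * x = x * l" for k
      by (simp_all add: add_mult_distrib)
    \<comment> \<open>The binomial coefficient cancels the \<open>(r + x)!\<close> in the
      denominator of \<open>block_moment\<close> and leaves \<open>r! x!\<close>; the powers with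
      exponent \<open>r + x\<close> split.\<close>
    show "(-1) ^ r * real (r + x choose x) * block_moment \<alpha> (V n) l n (r + x) =
          fact n * pochhammer (1 - \<alpha>) (l - 1) ^ x / (fact x * fact l ^ x) *
          ((-1) ^ r * pochhammer (1 - \<alpha>) (l - 1) ^ r /
               (fact r * fact l ^ r * fact (n - r * l - l * x)) *
             (\<Sum>k = r + x..r + x + (n - r * l - x * l).
                V n k * gen_stirling \<alpha> (n - r * l - x * l) (k - r - x)))"
      unfolding block_moment_def eqs
      by (simp add: binomial_fact power_add, simp only: mult_ac)
  qed
  finally show ?thesis .
qed

lemma expectation_block_count:
  assumes "n \<ge> 1" "l \<in> {1..n}"
  shows "expectation (\<lambda>\<omega>. real (block_count P l n \<omega>)) =
        real (n choose l) * pochhammer (1 - \<alpha>) (l - 1) *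
        (\<Sum>k = 1..1 + (n - l). V n k * gen_stirling \<alpha> (n - l) (k - 1))"
proof -
  \<comment> \<open>A block of size \<open>l\<close> fits into \<open>{1..n}\<close>, so the moment
    of order 1 occurs in the expansion; it is the derivative of the generating function at
    1.\<close>
  have "l \<ge> 1" "1 \<le> n div l"
    using assms by (auto simp: less_eq_div_iff_mult_less_eq)
  have "expectation (\<lambda>\<omega>. real (block_count P l n \<omega>)) =
        (\<Sum>A | partition_on {1..n} A. V n (card A) * (\<Prod>B\<in>A. pochhammer (1 - \<alpha>) (card B - 1)) *
            real (card {B \<in> A. card B = l}))"
    unfolding block_count_def by (rule expectation_restrict_partition) fact
  also have "\<dots> = block_moment \<alpha> (V n) l n 1"
    using derivative_recentred[OF pgf[OF \<open>l \<ge> 1\<close>] \<open>1 \<le> n div l\<close>] by (simp add: mult.commute)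
  finally show ?thesis
    using assms by (simp add: block_moment_def binomial_fact)
qed

end

theorem proposition3:
  fixes M :: "'w measure" and \<alpha> :: real and V :: "nat \<Rightarrow> nat \<Rightarrow> real"
    and P :: "'w \<Rightarrow> nat set set" and n l :: nat
  assumes "gibbs_partition M \<alpha> V P" and "n \<ge> 1" and "l \<in> {1..n}"
  shows
    "(\<forall>x \<in> {0..n div l}.
        measure M {\<omega> \<in> space M. block_count P l n \<omega> = x} =
          fact n * pochhammer (1 - \<alpha>) (l - 1) ^ x / (fact x * fact l ^ x) *
          (\<Sum>r = 0..n div l - x.
             (-1) ^ r * pochhammer (1 - \<alpha>) (l - 1) ^ r /
               (fact r * fact l ^ r * fact (n - r * l - l * x)) *
             (\<Sum>k = r + x..r + x + (n - r * l - x * l).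
                V n k * gen_stirling \<alpha> (n - r * l - x * l) (k - r - x)))) \<and>
     (\<integral>\<omega>. real (block_count P l n \<omega>) \<partial>M) =
        real (n choose l) * pochhammer (1 - \<alpha>) (l - 1) *
        (\<Sum>k = 1..1 + (n - l). V n k * gen_stirling \<alpha> (n - l) (k - 1)) \<and>
     (\<forall>x \<in> {0..n}.
        measure M {\<omega> \<in> space M. block_count P 1 n \<omega> = x} =
          fact n / fact x *
          (\<Sum>r = 0..n - x.
             (-1) ^ r / (fact r * fact (n - r - x)) *
             (\<Sum>k = r + x..r + x + (n - r - x).
                V n k * gen_stirling \<alpha> (n - r - x) (k - r - x)))) \<and>
     (\<integral>\<omega>. real (block_count P 1 n \<omega>) \<partial>M) =
        real n * (\<Sum>k = 1..1 + (n - 1). V n k * gen_stirling \<alpha> (n - 1) (k - 1))"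
proof -
  interpret gibbs_partition M \<alpha> V P
    by fact
  have l: "l \<ge> 1"
    using assms(3) by simp
  show ?thesis
  proof (intro conjI ballI, goal_cases)
    case (1 x)
    then show ?case
      using prob_block_count[OF assms(2) l, of x] by simp
  next
    case 2
    show ?case
      by (rule expectation_block_count) fact+
  next
    \<comment> \<open>For \<open>l = 1\<close> the factors
      \<open>pochhammer (1 - \<alpha>) 0\<close> and \<open>fact 1\<close> are both 1, and
      \<open>n div 1\<close> is \<open>n\<close>.\<close>
    case (3 x)
    then show ?case
      using prob_block_count[OF assms(2), of 1 x] by simp
  next
    case 4
    show ?case
      using expectation_block_count[OF assms(2), of 1] assms(2) by simp
  qed
qed

end
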